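(* Let $(X,p)$ be a partial metric space such that $p(x,x)=a$ for all $x\in X$, where $a$ is a fixed positive real number. Let $\mathcal{I}$ be an admissible ideal of $\mathbb{N}$ and let $r\ge 0$. Then for every sequence $\{x_n\}$ in $X$, $$\operatorname{diam}(\mathcal{I}\text{-}LIM^{r}x_n)\le 2r+2a.$$
   Context: A partial metric on a non-empty set $X$ is a function $p: X\times X \to [0,\infty)$ such that for all $x,y,z\in X$: (p1) $0\le p(x,x)\le p(x,y)$; (p2) $x=y$ if and only if $p(x,x)=p(x,y)=p(y,y)$; (p3) $p(x,y)=p(y,x)$; (p4) $p(x,y)\le p(x,z)+p(z,y)-p(z,z)$. Then $(X,p)$ is called a partial metric space. An ideal of $\mathbb{N}$ is a family $\mathcal{I}\subset 2^{\mathbb{N}}$ with $\emptyset\in\mathcal{I}$, closed under finite unions and under taking subsets. It is non-trivial if $\mathbb{N}\notin\mathcal{I}$ and $\mathcal{I}\neq\{\emptyset\}$. An admissible ideal is a non-trivial ideal containing $\{n\}$ for every $n\in\mathbb{N}$. For $r\ge 0$, a sequence $\{x_n\}$ in $X$ is rough $\mathcal{I}$-convergent of roughness degree $r$ to $x\in X$ if for every $\varepsilon>0$ the set $\{n\in\mathbb{N}: |p(x_n,x)-p(x,x)|\ge r+\varepsilon\}$ belongs to $\mathcal{I}$. The rough $\mathcal{I}$-limit set $\mathcal{I}\text{-}LIM^{r}x_n$ is the set of all $x\in X$ to which $\{x_n\}$ is rough $\mathcal{I}$-convergent of roughness degree $r$. For $B\subset X$, $\operatorname{diam}(B)=\sup\{p(x,y):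 x,y\in B\}$, the supremum being taken in $[0,\infty]$. *)

theory Defs
  imports "HOL-Library.Extended_Nonnegative_Real"
begin

(* Only the values of p on X are constrained; there p is nonnegative by p1. *)
locale partial_metric_space =
  fixes X :: "'a set" and p :: "'a \<Rightarrow> 'a \<Rightarrow> real"
  assumes nonempty: "X \<noteq> {}"
    and p1: "\<lbrakk>x \<in> X; y \<in> X\<rbrakk> \<Longrightarrow> 0 \<le> p x x \<and> p x x \<le> p x y"
    and p2: "\<lbrakk>x \<in> X; y \<in> X\<rbrakk> \<Longrightarrow> x = y \<longleftrightarrow> p x x = p x y \<and> p x y = p y y"
    and p3: "\<lbrakk>x \<in> X; y \<in> X\<rbrakk> \<Longrightarrow> p x y = p y x"
    and p4: "\<lbrakk>x \<in> X; y \<in> X; z \<in> X\<rbrakk> \<Longrightarrow> p x y \<le> p x z + p z y - p z z"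

definition set_ideal :: "nat set set \<Rightarrow> bool" where
  "set_ideal \<I> \<longleftrightarrow>
     {} \<in> \<I> \<and> (\<forall>A\<in>\<I>. \<forall>B\<in>\<I>. A \<union> B \<in> \<I>) \<and> (\<forall>A\<in>\<I>. \<forall>B. B \<subseteq> A \<longrightarrow> B \<in> \<I>)"

definition nontrivial_ideal :: "nat set set \<Rightarrow> bool" where
  "nontrivial_ideal \<I> \<longleftrightarrow> set_ideal \<I> \<and> UNIV \<notin> \<I> \<and> \<I> \<noteq> {{}}"

definition admissible_ideal :: "nat set set \<Rightarrow> bool" where
  "admissible_ideal \<I> \<longleftrightarrow> nontrivial_ideal \<I> \<and> (\<forall>n. {n} \<in> \<I>)"

definition rough_ideal_convergent ::
  "('a \<Rightarrow> 'a \<Rightarrow> real) \<Rightarrow> nat set set \<Rightarrow> real \<Rightarrow> (nat \<Rightarrow> 'a) \<Rightarrow> 'a \<Rightarrow> bool" where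
  "rough_ideal_convergent p \<I> r s x \<longleftrightarrow>
     (\<forall>\<epsilon>>0. {n. \<bar>p (s n) x - p x x\<bar> \<ge> r + \<epsilon>} \<in> \<I>)"

definition rough_ideal_LIM ::
  "'a set \<Rightarrow> ('a \<Rightarrow> 'a \<Rightarrow> real) \<Rightarrow> nat set set \<Rightarrow> real \<Rightarrow> (nat \<Rightarrow> 'a) \<Rightarrow> 'a set" where
  "rough_ideal_LIM X p \<I> r s = {x \<in> X. rough_ideal_convergent p \<I> r s x}"

(* ennreal is the type of [0,\<infinity>]; the supremum over the empty set is 0.  The coercion
   ennreal truncates negative reals, which do not occur as values of p on X. *)
definition partial_metric_diam :: "('a \<Rightarrow> 'a \<Rightarrow> real) \<Rightarrow> 'a set \<Rightarrow> ennreal" where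
  "partial_metric_diam p B = Sup {ennreal (p x y) | x y. x \<in> B \<and> y \<in> B}"

end

theory Submission
  imports Defs
begin

text \<open>
  Two rough limits \<open>x\<close> and \<open>y\<close> of one sequence share a good index: the two exceptional sets lie
  in the ideal, hence so does their union, which therefore cannot exhaust the natural numbers.
  At such an index \<open>n\<close> both \<open>p (s n) x\<close> and \<open>p (s n) y\<close> exceed the self-distances of \<open>x\<close> and \<open>y\<close>
  by less than \<open>r + \<epsilon>\<close>, and the triangle inequality through \<open>s n\<close> bounds \<open>p x y\<close> by
  \<open>2 * r + p x x + p y y + 2 * \<epsilon>\<close>.  The claim is the case in which all self-distances are \<open>a\<close>.
\<close>

lemma nontrivial_ideal_common_good_index:
  assumes "nontrivial_ideal \<I>" and "A \<in> \<I>" and "B \<in> \<I>"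
  obtains n where "n \<notin> A" and "n \<notin> B"
proof -
  have "A \<union> B \<in> \<I>" and "UNIV \<notin> \<I>"
    using assms by (auto simp: nontrivial_ideal_def set_ideal_def)
  then have "A \<union> B \<noteq> UNIV"
    by metis
  then show thesis
    using that by blast
qed

lemma (in partial_metric_space) rough_ideal_limits_distance_le:
  assumes ideal: "nontrivial_ideal \<I>"
    and s: "\<And>n. s n \<in> X"
    and x: "x \<in> rough_ideal_LIM X p \<I> r s"
    and y: "y \<in> rough_ideal_LIM X p \<I> r s"
  shows "p x y \<le> 2 * r + p x x + p y y"
proof (rule field_le_epsilon)
  fix e :: real
  assume "e > 0"
  \<comment> \<open>The slack is split evenly, since each of the two limits contributes its own error.\<close>
  then have "e / 2 > 0" by simp
  have X: "x \<in> X" "y \<in> X"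
    using x y by (auto simp: rough_ideal_LIM_def)
  have bad: "{n. \<bar>p (s n) z - p z z\<bar> \<ge> r + e / 2} \<in> \<I>"
    if "z \<in> rough_ideal_LIM X p \<I> r s" for z
    using that \<open>e / 2 > 0\<close>
    unfolding rough_ideal_LIM_def rough_ideal_convergent_def by blast
  obtain n where n: "\<bar>p (s n) x - p x x\<bar> < r + e / 2" "\<bar>p (s n) y - p y y\<bar> < r + e / 2"
    using nontrivial_ideal_common_good_index[OF ideal bad[OF x] bad[OF y]]
    by (metis (mono_tags, lifting) mem_Collect_eq not_le)
  have "p x y \<le> p x (s n) + p (s n) y - p (s n) (s n)"
    using p4 X s by blast
  moreover have "p x (s n) = p (s n) x"
    using p3 X s by blast
  moreover have "0 \<le> p (s n) (s n)"
    using p1 s by blast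
  ultimately show "p x y \<le> 2 * r + p x x + p y y + e"
    using n by linarith
qed

theorem theorem3p2:
  fixes X :: "'a set" and p :: "'a \<Rightarrow> 'a \<Rightarrow> real" and a r :: real
    and \<I> :: "nat set set" and s :: "nat \<Rightarrow> 'a"
  assumes "partial_metric_space X p"
    and "a > 0"
    and "\<forall>x\<in>X. p x x = a"
    and "admissible_ideal \<I>"
    and "r \<ge> 0"
    and "\<forall>n. s n \<in> X"
  shows "partial_metric_diam p (rough_ideal_LIM X p \<I> r s) \<le> ennreal (2 * r + 2 * a)"
proof -
  interpret partial_metric_space X p by fact
  have ideal: "nontrivial_ideal \<I>"
    using assms(4) by (simp add: admissible_ideal_def)
  have "p x y \<le> 2 * r + 2 * a"
    if "x \<in> rough_ideal_LIM X p \<I> r s" "y \<in> rough_ideal_LIM X p \<I> r s" for x y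
  proof -
    have "p x x = a" "p y y = a"
      using that assms(3) by (auto simp: rough_ideal_LIM_def)
    then show ?thesis
      using rough_ideal_limits_distance_le[OF ideal _ that] assms(6) by simp
  qed
  then show ?thesis
    unfolding partial_metric_diam_def by (auto intro!: Sup_least ennreal_leI)
qed

end
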